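(* Let $h$ and $n$ be integers with $0<h<n$. Then \[ \mathcal{N}_n(h)=n \frac{\varphi(h)}{h} - \varphi(h) - \sum_{d\mid h}\mu(d)\left\{\frac{n}{d}\right\} + \delta_{1h}\ . \]
   Context: For a positive integer $n$, the Farey sequence $F_n$ is the set of irreducible fractions $a/b$ with $0<a/b\leq 1$ and $1\leq b\leq n$ (the fraction $0/1$ is excluded, $1/1$ is included). $\mathcal{N}_n(h)$ denotes the number of fractions in $F_n$ whose (reduced) numerator equals $h$. $\varphi$ is Euler's totient function, $\mu$ the Möbius function, $\{x\}=x-\lfloor x\rfloor$ the fractional part, and $\delta_{1h}$ the Kronecker delta (equal to $1$ if $h=1$ and $0$ otherwise). *)

theory Defs
  imports Complex_Main "HOL-Number_Theory.Number_Theory" "HOL-Computational_Algebra.Squarefree"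
begin

definition moebius_mu :: "nat \<Rightarrow> int" where
  "moebius_mu n = (if squarefree n then (- 1) ^ card (prime_factors n) else 0)"

(* Fractions are elements of rat, so each one is counted once; 0/1 is excluded and 1/1 included. *)
definition farey :: "nat \<Rightarrow> rat set" where
  "farey n = {Fract a b | a b. coprime a b \<and> 0 < Fract a b \<and> Fract a b \<le> 1 \<and> 1 \<le> b \<and> b \<le> int n}"

(* The first component of quotient_of is the numerator in lowest terms, with positive denominator. *)
definition farey_num_count :: "nat \<Rightarrow> nat \<Rightarrow> nat" where
  "farey_num_count n h = card {r \<in> farey n. fst (quotient_of r) = int h}"

lemma finite_farey: "finite (farey n)"
proof (rule finite_subset)
  show "farey n \<subseteq> (\<lambda>(a, b). Fract a b) ` ({1..int n} \<times> {1..int n})"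
  proof
    fix r assume "r \<in> farey n"
    then obtain a b where ab: "r = Fract a b" "0 < Fract a b" "Fract a b \<le> 1" "1 \<le> b" "b \<le> int n"
      by (auto simp: farey_def)
    then have "0 < a" "a \<le> b"
      by (auto simp: zero_less_Fract_iff Fract_le_one_iff)
    with ab have "(a, b) \<in> {1..int n} \<times> {1..int n}"
      by auto
    with ab(1) show "r \<in> (\<lambda>(a, b). Fract a b) ` ({1..int n} \<times> {1..int n})"
      by force
  qed
qed auto

end

theory Submission
  imports Defs
begin

text \<open>
  The fractions in \<open>F\<^sub>n\<close> with numerator \<open>h\<close> correspond to the denominators \<open>b\<close> in \<open>{h..n}\<close> coprime
  to \<open>h\<close>. Those in \<open>{1..n}\<close> number \<open>\<Sum>\<^sub>d\<^sub>|\<^sub>h \<mu>(d) \<lfloor>n/d\<rfloor>\<close> by Moebius inversion of the coprimality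
  condition, and those in \<open>{1..<h}\<close> number \<open>\<phi>(h)\<close>, or \<open>0\<close> if \<open>h = 1\<close>. Taking \<open>n = h\<close> in the first
  count gives \<open>\<phi>(h)/h = \<Sum>\<^sub>d\<^sub>|\<^sub>h \<mu>(d)/d\<close>, which evaluates the main term.
\<close>

lemma moebius_mu_1 [simp]: "moebius_mu (Suc 0) = 1"
  by (simp add: moebius_mu_def)

text \<open>A new prime factor leaves squarefreeness unchanged and raises the number of prime
  factors by one, so the sign flips. If \<open>d\<close> is not squarefree, both sides are
  0.\<close>

lemma moebius_mu_prime_times:
  assumes "prime p" and "\<not> p dvd d"
  shows "moebius_mu (p * d) = - moebius_mu d"
proof -
  have "d \<noteq> 0"
    using assms(2) by (intro notI) simp
  have "coprime p d"
    using assms by (simp add: prime_imp_coprime)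
  then have sqf: "squarefree (p * d) \<longleftrightarrow> squarefree d"
    using squarefree_mult_coprime[of p d] squarefree_prime[of p] assms(1)
    by (auto dest: squarefree_multD)
  have "prime_factors (p * d) = insert p (prime_factors d)"
    using assms(1) \<open>d \<noteq> 0\<close> by (subst prime_factors_product) (auto simp: prime_prime_factors)
  moreover have "p \<notin> prime_factors d"
    using assms(2) by auto
  ultimately show ?thesis
    by (simp add: moebius_mu_def sqf)
qed

text \<open>For \<open>m > 1\<close>, fix a prime \<open>p\<close> dividing \<open>m\<close>.
  Multiplication by \<open>p\<close> pairs the squarefree divisors prime to \<open>p\<close> (the
  set \<open>A\<close>) with those divisible by \<open>p\<close>. Paired terms have opposite signs
  and cancel; the other divisors contribute 0.\<close>

lemma sum_moebius_mu_divisors: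
  assumes "m > 0"
  shows "(\<Sum>d | d dvd m. moebius_mu d) = (if m = 1 then 1 else 0)"
proof (cases "m = 1")
  case False
  then obtain p where p: "prime p" "p dvd m"
    using prime_factor_nat by blast
  define A where "A = {d. d dvd m \<and> squarefree d \<and> \<not> p dvd d}"
  have fin: "finite {d. d dvd m}"
    using assms by simp
  then have finA: "finite A"
    by (rule rev_finite_subset) (auto simp: A_def)
  have inj: "inj_on ((*) p) A"
    using p(1) by (auto simp: inj_on_def dest: prime_gt_0_nat)
  have supp: "{d. d dvd m \<and> squarefree d} = A \<union> (*) p ` A"
  proof (intro equalityI subsetI)
    fix d assume d: "d \<in> {d. d dvd m \<and> squarefree d}"
    show "d \<in> A \<union> (*) p ` A"
    proof (cases "p dvd d")
      case True
      then obtain e where e: "d = p * e" ..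
      have "\<not> p dvd e"
      proof
        assume "p dvd e"
        then have "p ^ 2 dvd d"
          using e by (simp add: power2_eq_square)
        then have "p dvd 1"
          using d by (auto dest: squarefreeD)
        with p(1) show False by auto
      qed
      moreover have "squarefree e" "e dvd m"
        using d e by (auto dest: squarefree_multD dvd_mult_right)
      ultimately show ?thesis
        using e by (auto simp: A_def)
    qed (use d in \<open>auto simp: A_def\<close>)
  next
    fix d assume "d \<in> A \<union> (*) p ` A"
    then show "d \<in> {d. d dvd m \<and> squarefree d}"
    proof
      assume "d \<in> (*) p ` A"
      then obtain e where e: "d = p * e" "e dvd m" "squarefree e" "\<not> p dvd e"
        by (auto simp: A_def)
      have "coprime p e"
        using p(1) e(4) by (simp add: prime_imp_coprime)
      then show ?thesis
        using e p by (auto simp: divides_mult intro: squarefree_mult_coprime squarefree_prime)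
    qed (auto simp: A_def)
  qed
  have "(\<Sum>d | d dvd m. moebius_mu d) = (\<Sum>d | d dvd m \<and> squarefree d. moebius_mu d)"
    using fin by (intro sum.mono_neutral_right) (auto simp: moebius_mu_def)
  also have "\<dots> = (\<Sum>d\<in>A. moebius_mu d) + (\<Sum>d\<in>(*) p ` A. moebius_mu d)"
    unfolding supp using finA by (intro sum.union_disjoint) (auto simp: A_def)
  also have "(\<Sum>d\<in>(*) p ` A. moebius_mu d) = (\<Sum>d\<in>A. - moebius_mu d)"
    unfolding sum.reindex[OF inj] o_def
    by (rule sum.cong) (auto simp: A_def moebius_mu_prime_times p(1))
  finally show ?thesis
    using False by (simp add: sum_negf)
qed (simp add: moebius_mu_def)

lemma card_multiples_atMost:
  assumes "d > 0"
  shows "card {b \<in> {1..n}. d dvd b} = n div (d :: nat)"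
proof -
  have "{b \<in> {1..n}. d dvd b} = (*) d ` {1..n div d}"
  proof (intro equalityI subsetI)
    fix b assume b: "b \<in> {b \<in> {1..n}. d dvd b}"
    then obtain k where "b = d * k" by auto
    with b assms show "b \<in> (*) d ` {1..n div d}"
      by (auto simp: less_eq_div_iff_mult_less_eq mult.commute intro!: imageI)
  qed (use assms in \<open>auto simp: less_eq_div_iff_mult_less_eq mult.commute\<close>)
  moreover have "inj_on ((*) d) {1..n div d}"
    using assms by (auto simp: inj_on_def)
  ultimately show ?thesis
    by (simp add: card_image)
qed

text \<open>Writing the indicator of \<open>gcd h b = 1\<close> as the sum of
  \<open>moebius_mu\<close> over the divisors of the gcd and swapping the two sums leaves, for each
  \<open>d\<close>, a count of the multiples of \<open>d\<close> up to \<open>n\<close>.\<close>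

lemma card_coprime_atMost:
  fixes h n :: nat
  assumes "h > 0"
  shows "int (card {b \<in> {1..n}. coprime h b}) = (\<Sum>d | d dvd h. moebius_mu d * int (n div d))"
proof -
  have fin: "finite {d. d dvd h}"
    using assms by simp
  have "int (card {b \<in> {1..n}. coprime h b}) = (\<Sum>b\<in>{1..n}. if coprime h b then 1 else 0)"
    by (simp flip: sum.inter_filter)
  also have "\<dots> = (\<Sum>b\<in>{1..n}. \<Sum>d | d dvd gcd h b. moebius_mu d)"
  proof (rule sum.cong[OF refl])
    fix b
    show "(if coprime h b then 1 else 0) = (\<Sum>d | d dvd gcd h b. moebius_mu d)"
      using sum_moebius_mu_divisors[of "gcd h b"] assms by (simp only: coprime_iff_gcd_eq_1) simp
  qed
  also have "\<dots> = (\<Sum>b\<in>{1..n}. \<Sum>d | d dvd h \<and> d dvd b. moebius_mu d)"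
    by simp
  also have "\<dots> = (\<Sum>d | d dvd h. \<Sum>b | b \<in> {1..n} \<and> d dvd b. moebius_mu d)"
    using sum.swap_restrict[of "{1..n}" "{d. d dvd h}" "\<lambda>b d. moebius_mu d" "\<lambda>b d. d dvd b"] fin
    by simp
  also have "\<dots> = (\<Sum>d | d dvd h. moebius_mu d * int (n div d))"
  proof (rule sum.cong[OF refl])
    fix d assume "d \<in> {d. d dvd h}"
    then have "d > 0"
      using assms by (auto intro: Nat.gr0I)
    then show "(\<Sum>b | b \<in> {1..n} \<and> d dvd b. moebius_mu d) = moebius_mu d * int (n div d)"
      using card_multiples_atMost[of d n] by simp
  qed
  finally show ?thesis .
qed

lemma totient_over_self:
  assumes "h > 0"
  shows "real (totient h) / real h = (\<Sum>d | d dvd h. real_of_int (moebius_mu d) / real d)"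
proof -
  have "totatives h = {b \<in> {1..h}. coprime h b}"
    by (auto simp: totatives_def coprime_commute)
  then have "int (totient h) = (\<Sum>d | d dvd h. moebius_mu d * int (h div d))"
    using card_coprime_atMost[OF assms, of h] by (simp add: totient_def)
  then have "real (totient h) = (\<Sum>d | d dvd h. real_of_int (moebius_mu d * int (h div d)))"
    by (metis of_int_of_nat_eq of_int_sum)
  \<comment> \<open>Every \<open>d\<close> here divides \<open>h\<close>, so \<open>h div d\<close>
    is the exact quotient and no fractional part appears.\<close>
  also have "\<dots> = (\<Sum>d | d dvd h. real h * (real_of_int (moebius_mu d) / real d))"
    by (rule sum.cong) (auto simp: real_of_nat_div)
  finally have "real (totient h) = real h * (\<Sum>d | d dvd h. real_of_int (moebius_mu d) / real d)"
    by (simp only: sum_distrib_left)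
  with assms show ?thesis
    by (simp add: field_simps)
qed

text \<open>A coprime pair with positive denominator is what \<open>quotient_of\<close> returns, so
  numerator \<open>h\<close> forces the form h/b with \<open>b\<close> coprime to \<open>h\<close>.
  The bound by 1 then becomes h \<le> b, and distinct \<open>b\<close> give distinct fractions
  because \<open>h\<close> is nonzero.\<close>

lemma farey_num_count_eq_card_coprime:
  assumes "h > 0"
  shows "farey_num_count n h = card {b \<in> {h..n}. coprime h b}"
proof -
  let ?B = "{b \<in> {h..n}. coprime h b}"
  let ?f = "\<lambda>b. Fract (int h) (int b)"
  have quot: "quotient_of (Fract a b) = (a, b)" if "coprime a b" "b > 0" for a b
    using that by (simp add: quotient_of_Fract normalize_stable)
  have "{r \<in> farey n. fst (quotient_of r) = int h} = ?f ` ?B"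
  proof (intro equalityI subsetI)
    fix r assume "r \<in> {r \<in> farey n. fst (quotient_of r) = int h}"
    then obtain a b where ab: "r = Fract a b" "coprime a b" "Fract a b \<le> 1" "1 \<le> b" "b \<le> int n"
      and "fst (quotient_of r) = int h"
      by (auto simp: farey_def)
    then have "a = int h" "int h \<le> b"
      by (auto simp: quot Fract_le_one_iff)
    moreover obtain c where "b = int c"
      using ab(4) nonneg_int_cases[of b] by auto
    ultimately show "r \<in> ?f ` ?B"
      using ab by auto
  next
    fix r assume "r \<in> ?f ` ?B"
    then obtain b where b: "r = ?f b" "h \<le> b" "b \<le> n" "coprime h b"
      by auto
    then have "r \<in> farey n"
      unfolding farey_def mem_Collect_eq using assms
      by (intro exI[of _ "int h"] exI[of _ "int b"])
        (auto simp: zero_less_Fract_iff Fract_le_one_iff)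
    with b assms show "r \<in> {r \<in> farey n. fst (quotient_of r) = int h}"
      by (auto simp: quot)
  qed
  moreover have "inj_on ?f ?B"
    using assms by (auto simp: inj_on_def eq_rat)
  ultimately show ?thesis
    by (simp add: farey_num_count_def card_image)
qed

theorem theorem1:
  fixes h n :: nat
  assumes "0 < h" and "h < n"
  shows "real (farey_num_count n h) =
           real n * (real (totient h) / real h) - real (totient h)
           - (\<Sum>d | d dvd h. real_of_int (moebius_mu d) * frac (real n / real d))
           + (if h = 1 then 1 else 0)"
proof -
  let ?C = "\<lambda>S. {b \<in> S. coprime h b}"
  \<comment> \<open>This is the source of the Kronecker delta: for \<open>h = 1\<close> the range is
    empty while the totient is 1. For \<open>h > 1\<close>, \<open>h\<close> is not coprime to
    itself, so leaving it out of the range loses nothing.\<close>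
  have below: "card (?C {1..<h}) + (if h = 1 then 1 else 0) = totient h"
  proof (cases "h = 1")
    case False
    then have "?C {1..<h} = totatives h"
      using assms(1) by (auto simp: in_totatives_iff coprime_commute le_less)
    with False show ?thesis
      by (simp add: totient_def)
  qed simp
  have "?C {1..n} = ?C {1..<h} \<union> ?C {h..n}"
    using assms by auto
  then have "card (?C {1..n}) = card (?C {1..<h}) + card (?C {h..n})"
    by (simp only:) (rule card_Un_disjoint, auto)
  then have count: "real (farey_num_count n h)
      = real (card (?C {1..n})) - real (totient h) + (if h = 1 then 1 else 0)"
    using below farey_num_count_eq_card_coprime[OF assms(1), of n] by (auto split: if_splits)
  have "real (card (?C {1..n})) = (\<Sum>d | d dvd h. real_of_int (moebius_mu d * int (n div d)))"
    using card_coprime_atMost[OF assms(1), of n] by (metis of_int_of_nat_eq of_int_sum)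
  \<comment> \<open>The natural number \<open>n div d\<close> is the floor of n/d, that is, n/d
    minus its fractional part.\<close>
  also have "\<dots> = (\<Sum>d | d dvd h. real n * (real_of_int (moebius_mu d) / real d)
      - real_of_int (moebius_mu d) * frac (real n / real d))"
    by (rule sum.cong) (simp_all add: frac_def floor_divide_of_nat_eq algebra_simps)
  also have "\<dots> = real n * (real (totient h) / real h)
      - (\<Sum>d | d dvd h. real_of_int (moebius_mu d) * frac (real n / real d))"
    by (simp only: sum_subtractf totient_over_self[OF assms(1)] sum_distrib_left)
  finally show ?thesis
    using count by simp
qed

end
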